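(* Let $r=r(z)=\frac{1-2z^2-\sqrt{1-4z^2}}{2z^2}$. For $k\ge0$ let $f_k(z)$ (resp. $g_k(z)$) be the generating function whose coefficient of $z^n$ is the number of partial zigzag knight's paths of length $n$ (number of steps) ending at height $k$ whose last step is an up-step $N$ or $E$ (resp. a down-step $\bar N$ or $\bar E$), the empty path being counted in $f_0$. Let $F(u)=\sum_{k\ge0}u^kf_k$ and $G(u)=\sum_{k\ge0}u^kg_k$. Then $$F(u)=\frac{ru^2+ur(1-z)+z}{z(1-ru)},\qquad G(u)=\frac{r(u+r+2)}{1-ru},\qquad F(u)+G(u)=\frac{r^2z+ru^2+ru+2rz+z}{z(1-ru)}.$$ Moreover $f_0=1$; $f_k=\frac{1+r}{z}r^{k-1}-[k=1]\frac1z$ for $k\ge1$; $g_0=r(2+r)$; and $g_k=\frac{r^{k+1}}{z^2}$ for $k\ge1$, where $[k=1]$ equals $1$ if $k=1$ and $0$ otherwise.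
   Context: Let $N=(1,2)$, $\bar N=(1,-2)$, $E=(2,1)$, $\bar E=(2,-1)$; $N,E$ are up-steps and $\bar N,\bar E$ are down-steps. A knight's path is a lattice path in $\mathbb N^2$ starting at $(0,0)$, ending on the $x$-axis, with steps in $\{N,\bar N,E,\bar E\}$. A zigzag knight's path is a knight's path in which consecutive steps alternate between up-steps and down-steps. A partial zigzag knight's path is a prefix (possibly empty) of a zigzag knight's path. The length of a path is its number of steps; the height of a point is its ordinate. *)

theory Defs
  imports "HOL-Computational_Algebra.Formal_Laurent_Series" "HOL-Library.Product_Plus"
begin

definition up_steps :: "(int \<times> int) set" where
  "up_steps = {(1, 2), (2, 1)}"

definition down_steps :: "(int \<times> int) set" where
  "down_steps = {(1, -2), (2, -1)}"

text \<open>A path starting at the origin is represented by the list of its steps; the points it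
  visits are the partial sums of that list.\<close>

definition path_point :: "(int \<times> int) list \<Rightarrow> nat \<Rightarrow> int \<times> int" where
  "path_point s i = sum_list (take i s)"

definition end_height :: "(int \<times> int) list \<Rightarrow> int" where
  "end_height s = snd (path_point s (length s))"

definition knight_path :: "(int \<times> int) list \<Rightarrow> bool" where
  "knight_path s \<longleftrightarrow> set s \<subseteq> up_steps \<union> down_steps \<and>
     (\<forall>i\<le>length s. 0 \<le> fst (path_point s i) \<and> 0 \<le> snd (path_point s i)) \<and>
     end_height s = 0"

definition zigzag_knight_path :: "(int \<times> int) list \<Rightarrow> bool" where
  "zigzag_knight_path s \<longleftrightarrow> knight_path s \<and>
     (\<forall>i. Suc i < length s \<longrightarrow>
        (s ! i \<in> up_steps \<and> s ! Suc i \<in> down_steps) \<or>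
        (s ! i \<in> down_steps \<and> s ! Suc i \<in> up_steps))"

definition partial_zigzag_knight_path :: "(int \<times> int) list \<Rightarrow> bool" where
  "partial_zigzag_knight_path s \<longleftrightarrow> (\<exists>t. zigzag_knight_path (s @ t))"

definition f_paths :: "nat \<Rightarrow> nat \<Rightarrow> (int \<times> int) list set" where
  "f_paths k n = {s. partial_zigzag_knight_path s \<and> length s = n \<and> end_height s = int k \<and>
     (s = [] \<or> last s \<in> up_steps)}"

definition g_paths :: "nat \<Rightarrow> nat \<Rightarrow> (int \<times> int) list set" where
  "g_paths k n = {s. partial_zigzag_knight_path s \<and> length s = n \<and> end_height s = int k \<and>
     s \<noteq> [] \<and> last s \<in> down_steps}"

text \<open>Series in \<open>z\<close> are embedded into the field of formal Laurent series, where division by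
  powers of \<open>z\<close> has its usual meaning; bivariate series are power series in \<open>u\<close> over that field.\<close>

definition f_gf :: "nat \<Rightarrow> real fls" where
  "f_gf k = fps_to_fls (Abs_fps (\<lambda>n. real (card (f_paths k n))))"

definition g_gf :: "nat \<Rightarrow> real fls" where
  "g_gf k = fps_to_fls (Abs_fps (\<lambda>n. real (card (g_paths k n))))"

definition F_gf :: "real fls fps" where
  "F_gf = Abs_fps f_gf"

definition G_gf :: "real fls fps" where
  "G_gf = Abs_fps g_gf"

text \<open>The radical below is the square root of \<open>1 - 4z\<^sup>2\<close> with constant coefficient \<open>1\<close>.\<close>

definition r_series :: "real fls" where
  "r_series = (1 - 2 * fls_X ^ 2 - fps_to_fls (fps_radical root 2 (1 - 4 * fps_X ^ 2))) /
     (2 * fls_X ^ 2)"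

end

(* Non-negativity of abscissae is automatic, and every alternating path staying above the axis can
   be completed by steps (2,1), (1,-2), each pair lowering the height by one. Hence partial zigzag
   paths are built one step at a time, which gives f_1 = z(g_0 + 1), f_2 = z(g_1 + g_0 + 1),
   f_k = z(g_(k-1) + g_(k-2)) for k > 2, and g_k = z(f_(k+1) + f_(k+2)). Each equation carries a
   factor z, so the system has exactly one solution in power series, and the closed forms solve it
   because r = z^2 (1 + r)^2. *)
theory Submission imports Defs begin

section \<open>Initial segments of zigzag paths and their completion\<close>

text \<open>A description of partial zigzag paths without reference to a completion: every condition
  passes to initial segments, so paths can be analysed by their last step.
  \<open>partial_zigzag_iff\<close> links it to the original notion.\<close>

definition zigzag_prefix :: "(int \<times> int) list \<Rightarrow> bool" where
  "zigzag_prefix s \<longleftrightarrow> set s \<subseteq> up_steps \<union> down_steps \<and>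
     (\<forall>i\<le>length s. 0 \<le> snd (path_point s i)) \<and>
     (\<forall>i. Suc i < length s \<longrightarrow>
        (s ! i \<in> up_steps \<and> s ! Suc i \<in> down_steps) \<or>
        (s ! i \<in> down_steps \<and> s ! Suc i \<in> up_steps))"

lemma end_height_Nil [simp]: "end_height [] = 0"
  by (simp add: end_height_def path_point_def)

lemma end_height_snoc [simp]: "end_height (s @ [x]) = end_height s + snd x"
  by (simp add: end_height_def path_point_def)

lemma up_down_disjoint: "x \<in> up_steps \<Longrightarrow> x \<notin> down_steps"
  by (auto simp: up_steps_def down_steps_def)

lemma zigzag_prefix_Nil [simp]: "zigzag_prefix []"
  by (simp add: zigzag_prefix_def path_point_def)

lemma path_point_append: "i \<le> length s \<Longrightarrow> path_point (s @ t) i = path_point s i"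
  by (simp add: path_point_def)

lemma zigzag_prefix_appendD: "zigzag_prefix (s @ t) \<Longrightarrow> zigzag_prefix s"
proof -
  assume a: "zigzag_prefix (s @ t)"
  have "0 \<le> snd (path_point s i)" if "i \<le> length s" for i
  proof -
    have "i \<le> length (s @ t)" using that by simp
    then have "0 \<le> snd (path_point (s @ t) i)"
      using a unfolding zigzag_prefix_def by blast
    then show ?thesis using that by (simp add: path_point_append)
  qed
  moreover have "(s ! i \<in> up_steps \<and> s ! Suc i \<in> down_steps) \<or>
        (s ! i \<in> down_steps \<and> s ! Suc i \<in> up_steps)" if "Suc i < length s" for i
  proof -
    have "Suc i < length (s @ t)" using that by simp
    then have "((s @ t) ! i \<in> up_steps \<and> (s @ t) ! Suc i \<in> down_steps) \<or>
        ((s @ t) ! i \<in> down_steps \<and> (s @ t) ! Suc i \<in> up_steps)"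
      using a unfolding zigzag_prefix_def by blast
    then show ?thesis using that by (simp add: nth_append)
  qed
  ultimately show ?thesis using a by (auto simp: zigzag_prefix_def)
qed

text \<open>Appending a step creates one new point, the end point, and one new junction, at index
  \<open>length s - 1\<close>; only these two have to be checked.\<close>

lemma zigzag_prefix_snoc:
  "zigzag_prefix (s @ [x]) \<longleftrightarrow> zigzag_prefix s \<and> 0 \<le> end_height s + snd x \<and>
     (x \<in> up_steps \<and> (s = [] \<or> last s \<in> down_steps) \<or>
      x \<in> down_steps \<and> (s = [] \<or> last s \<in> up_steps))" (is "_ \<longleftrightarrow> ?R")
proof
  assume a: "zigzag_prefix (s @ [x])"
  have "0 \<le> snd (path_point (s @ [x]) (length (s @ [x])))"
    using a unfolding zigzag_prefix_def by blast
  then have h: "0 \<le> end_height s + snd x"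
    unfolding end_height_def[symmetric] by simp
  have x: "x \<in> up_steps \<union> down_steps"
    using a by (simp add: zigzag_prefix_def)
  have "(last s \<in> up_steps \<and> x \<in> down_steps) \<or> (last s \<in> down_steps \<and> x \<in> up_steps)"
    if "s \<noteq> []"
  proof -
    have "Suc (length s - 1) < length (s @ [x])" using that by simp
    then have "((s @ [x]) ! (length s - 1) \<in> up_steps \<and> (s @ [x]) ! Suc (length s - 1) \<in> down_steps) \<or>
       ((s @ [x]) ! (length s - 1) \<in> down_steps \<and> (s @ [x]) ! Suc (length s - 1) \<in> up_steps)"
      using a unfolding zigzag_prefix_def by blast
    then show ?thesis using that by (simp add: nth_append last_conv_nth)
  qed
  then show ?R using zigzag_prefix_appendD[OF a] h x by blast
next
  assume R: ?R
  have "0 \<le> snd (path_point (s @ [x]) i)" if "i \<le> length (s @ [x])" for i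
  proof (cases "i \<le> length s")
    case True
    then show ?thesis using R by (simp add: path_point_append zigzag_prefix_def)
  next
    case False
    then have "i = length (s @ [x])" using that by simp
    then have "snd (path_point (s @ [x]) i) = end_height (s @ [x])"
      by (simp only: end_height_def)
    then show ?thesis using R by simp
  qed
  moreover have "((s @ [x]) ! i \<in> up_steps \<and> (s @ [x]) ! Suc i \<in> down_steps) \<or>
       ((s @ [x]) ! i \<in> down_steps \<and> (s @ [x]) ! Suc i \<in> up_steps)"
    if "Suc i < length (s @ [x])" for i
  proof (cases "Suc i < length s")
    case True
    then show ?thesis using R by (simp add: zigzag_prefix_def nth_append)
  next
    case False
    then have "i = length s - 1" "s \<noteq> []" using that by auto
    then show ?thesis using R by (auto simp: nth_append last_conv_nth)
  qed
  ultimately show "zigzag_prefix (s @ [x])"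
    using R unfolding zigzag_prefix_def by auto
qed

lemma end_height_nonneg: "zigzag_prefix s \<Longrightarrow> 0 \<le> end_height s"
  by (simp add: zigzag_prefix_def end_height_def)

text \<open>The last step adds at least 1 to a nonnegative height. This leaves room for a down-step
  \<open>(2, -1)\<close> and shows that only the empty path is counted in
  \<open>f_paths 0\<close>.\<close>

lemma end_height_up_pos:
  assumes "zigzag_prefix s" "s \<noteq> []" "last s \<in> up_steps"
  shows "0 < end_height s"
proof -
  obtain t x where s: "s = t @ [x]" using assms(2) by (metis rev_exhaust)
  then show ?thesis using assms end_height_nonneg[of t]
    by (auto simp: zigzag_prefix_snoc up_steps_def)
qed

lemma path_point_fst_nonneg:
  assumes "set s \<subseteq> up_steps \<union> down_steps"
  shows "0 \<le> fst (path_point s i)"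
proof -
  have "0 \<le> fst (sum_list t)" if "set t \<subseteq> up_steps \<union> down_steps" for t :: "(int \<times> int) list"
    using that by (induction t) (auto simp: up_steps_def down_steps_def)
  then show ?thesis
    using assms set_take_subset[of i s] unfolding path_point_def by blast
qed

lemma zigzag_knight_path_iff: "zigzag_knight_path s \<longleftrightarrow> zigzag_prefix s \<and> end_height s = 0"
  unfolding zigzag_knight_path_def knight_path_def zigzag_prefix_def
  using path_point_fst_nonneg by blast

text \<open>Induction on the height h: the pair \<open>(2, 1)\<close>, \<open>(1, -2)\<close> visits
  heights h + 1 and h - 1, so for h > 0 it stays above the axis, and it ends with a down-step again.
  At height 0 the path is already complete.\<close>

lemma complete_from_down:
  assumes "zigzag_prefix s" "s = [] \<or> last s \<in> down_steps"
  shows "\<exists>t. zigzag_knight_path (s @ t)"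
  using assms
proof (induction "nat (end_height s)" arbitrary: s)
  case 0
  then have "zigzag_knight_path (s @ [])"
    using end_height_nonneg[of s] by (simp add: zigzag_knight_path_iff)
  then show ?case by blast
next
  case (Suc m)
  let ?u = "s @ [(2, 1)]"
  have h: "end_height s = int m + 1" using Suc.hyps(2) by simp
  have u: "zigzag_prefix ?u" unfolding zigzag_prefix_snoc
    using Suc.prems h by (auto simp: up_steps_def)
  have d: "zigzag_prefix (?u @ [(1, -2)])" unfolding zigzag_prefix_snoc[of ?u]
    using u h by (simp add: up_steps_def down_steps_def)
  have "nat (end_height (?u @ [(1, -2)])) = m"
    unfolding end_height_snoc using h by simp
  then obtain t where "zigzag_knight_path ((?u @ [(1, -2)]) @ t)"
    using Suc.hyps(1)[OF _ d] by (auto simp: down_steps_def)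
  then show ?case by (metis append_assoc)
qed

lemma partial_zigzag_iff: "partial_zigzag_knight_path s \<longleftrightarrow> zigzag_prefix s"
proof
  assume "partial_zigzag_knight_path s"
  then show "zigzag_prefix s"
    unfolding partial_zigzag_knight_path_def zigzag_knight_path_iff
    using zigzag_prefix_appendD by blast
next
  assume a: "zigzag_prefix s"
  show "partial_zigzag_knight_path s"
  proof (cases "s = [] \<or> last s \<in> down_steps")
    case True
    then show ?thesis using complete_from_down[OF a]
      by (simp add: partial_zigzag_knight_path_def)
  next
    case False
    then have ls: "s \<noteq> []" "last s \<in> up_steps"
      using a last_in_set[of s] unfolding zigzag_prefix_def by blast+
    \<comment> \<open>After an up-step the height may be only 1, so the shallower down-step is
      chosen; it reduces this case to \<open>complete_from_down\<close>.\<close>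
    have "zigzag_prefix (s @ [(2, -1)])"
      using a end_height_up_pos[OF a ls] ls by (simp add: zigzag_prefix_snoc down_steps_def)
    then obtain t where "zigzag_knight_path ((s @ [(2, -1)]) @ t)"
      using complete_from_down[of "s @ [(2, -1)]"] by (auto simp: down_steps_def)
    then show ?thesis unfolding partial_zigzag_knight_path_def by (metis append_assoc)
  qed
qed

section \<open>Decomposition by the last step, and cardinalities\<close>

text \<open>The paths after which the next step is an up-step, with the empty path included.\<close>

definition ground_paths :: "nat \<Rightarrow> nat \<Rightarrow> (int \<times> int) list set" where
  "ground_paths k n = {s. zigzag_prefix s \<and> length s = n \<and> end_height s = int k \<and>
     (s = [] \<or> last s \<in> down_steps)}"

lemma f_paths_0: "f_paths k 0 = (if k = 0 then {[]} else {})"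
  by (auto simp: f_paths_def partial_zigzag_iff)

lemma g_paths_0: "g_paths k 0 = {}"
  by (auto simp: g_paths_def)

lemma f_paths_0_Suc: "f_paths 0 (Suc n) = {}"
  using end_height_up_pos by (force simp: f_paths_def partial_zigzag_iff)

lemma snoc_cases:
  assumes "length s = Suc n"
  obtains t x where "s = t @ [x]" "length t = n"
  using assms by (metis length_Suc_conv_rev)

text \<open>The differences \<open>k - 1\<close> and \<open>k - 2\<close> truncate at 0; the guards
  empty the sets whose true starting height would be negative.\<close>

lemma f_paths_Suc:
  "f_paths k (Suc n) = (\<lambda>s. s @ [(2, 1)]) ` {s \<in> ground_paths (k - 1) n. k \<ge> 1} \<union>
     (\<lambda>s. s @ [(1, 2)]) ` {s \<in> ground_paths (k - 2) n. k \<ge> 2}" (is "_ = ?R")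
proof (intro set_eqI iffI)
  fix s assume s: "s \<in> f_paths k (Suc n)"
  then obtain t x where tx: "s = t @ [x]" "length t = n"
    by (auto simp: f_paths_def elim: snoc_cases)
  have "x \<in> up_steps" and z: "zigzag_prefix (t @ [x])" and "end_height t + snd x = int k"
    using s tx by (auto simp: f_paths_def partial_zigzag_iff)
  \<comment> \<open>The height of the shortened path equals \<open>int k - snd x\<close>; its
    nonnegativity yields the guards.\<close>
  moreover have "0 \<le> end_height t"
    using zigzag_prefix_appendD[OF z] by (rule end_height_nonneg)
  ultimately show "s \<in> ?R"
    using tx up_down_disjoint
    by (auto simp: ground_paths_def zigzag_prefix_snoc up_steps_def of_nat_diff)
next
  fix s assume "s \<in> ?R"
  then show "s \<in> f_paths k (Suc n)"
    \<comment> \<open>If the shortened path is empty, \<open>[] @ [x]\<close> is simplified to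
      \<open>[x]\<close>, to which only these instances of the snoc rules apply.\<close>
    using zigzag_prefix_snoc[of "[]"] end_height_snoc[of "[]"]
    by (auto simp: f_paths_def partial_zigzag_iff ground_paths_def zigzag_prefix_snoc
        up_steps_def of_nat_diff)
qed

lemma g_paths_Suc:
  "g_paths k (Suc n) = (\<lambda>s. s @ [(2, -1)]) ` f_paths (k + 1) n \<union>
     (\<lambda>s. s @ [(1, -2)]) ` f_paths (k + 2) n" (is "_ = ?R")
proof (intro set_eqI iffI)
  fix s assume s: "s \<in> g_paths k (Suc n)"
  then obtain t x where tx: "s = t @ [x]" "length t = n"
    by (auto simp: g_paths_def elim: snoc_cases)
  have "x \<in> down_steps" and "zigzag_prefix (t @ [x])" and "end_height t + snd x = int k"
    using s tx by (auto simp: g_paths_def partial_zigzag_iff)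
  then show "s \<in> ?R"
    using tx up_down_disjoint
    by (auto simp: f_paths_def partial_zigzag_iff zigzag_prefix_snoc down_steps_def)
next
  fix s assume "s \<in> ?R"
  then show "s \<in> g_paths k (Suc n)"
    by (auto simp: g_paths_def f_paths_def partial_zigzag_iff zigzag_prefix_snoc down_steps_def)
qed

text \<open>The extra empty path is the source of the summand 1 in the equations for heights 1 and
  2.\<close>

lemma ground_paths_eq:
  "ground_paths k n = g_paths k n \<union> (if k = 0 \<and> n = 0 then {[]} else {})"
  by (auto simp: ground_paths_def g_paths_def partial_zigzag_iff)

lemma finite_f_paths: "finite (f_paths k n)" and finite_g_paths: "finite (g_paths k n)"
proof -
  have "finite {s. set s \<subseteq> up_steps \<union> down_steps \<and> length s = n}"
    by (rule finite_lists_length_eq) (simp add: up_steps_def down_steps_def)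
  then show "finite (f_paths k n)" "finite (g_paths k n)"
    by (auto simp: f_paths_def g_paths_def partial_zigzag_iff zigzag_prefix_def
        elim!: finite_subset[rotated])
qed

lemma card_snoc_Un:
  assumes "finite A" "finite B" "x \<noteq> y"
  shows "card ((\<lambda>s. s @ [x]) ` A \<union> (\<lambda>s. s @ [y]) ` B) = card A + card B"
proof -
  have "inj_on (\<lambda>s. s @ [x]) A" "inj_on (\<lambda>s. s @ [y]) B"
    by (simp_all add: inj_on_def)
  then show ?thesis using assms by (subst card_Un_disjoint) (auto simp: card_image)
qed

lemma finite_ground_paths: "finite (ground_paths k n)"
  by (simp add: ground_paths_eq finite_g_paths)

lemma card_ground_paths:
  "card (ground_paths k n) = card (g_paths k n) + (if k = 0 \<and> n = 0 then 1 else 0)"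
  by (simp add: ground_paths_eq g_paths_0)

lemma card_g_paths_Suc:
  "card (g_paths k (Suc n)) = card (f_paths (k + 1) n) + card (f_paths (k + 2) n)"
  unfolding g_paths_Suc by (rule card_snoc_Un) (simp_all add: finite_f_paths)

lemma card_f_paths_Suc:
  "card (f_paths k (Suc n)) =
     (if k \<ge> 1 then card (ground_paths (k - 1) n) else 0) +
     (if k \<ge> 2 then card (ground_paths (k - 2) n) else 0)"
  unfolding f_paths_Suc
  by (subst card_snoc_Un; cases "k \<ge> 1"; cases "k \<ge> 2") (simp_all add: finite_ground_paths)

section \<open>The functional equations and their unique solution\<close>

text \<open>The series behind \<open>f_gf\<close>, before the embedding into Laurent series:
  uniqueness is proved by induction on coefficients of power series.\<close>

definition f_fps :: "nat \<Rightarrow> real fps" where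
  "f_fps k = Abs_fps (\<lambda>n. real (card (f_paths k n)))"

definition g_fps :: "nat \<Rightarrow> real fps" where
  "g_fps k = Abs_fps (\<lambda>n. real (card (g_paths k n)))"

text \<open>Heights 1 and 2 are separate because the empty path, at height 0, can precede an up-step
  to them; the shift to \<open>k + 3\<close> avoids truncated subtraction.\<close>

definition zigzag_system :: "(nat \<Rightarrow> real fps) \<Rightarrow> (nat \<Rightarrow> real fps) \<Rightarrow> bool" where
  "zigzag_system f g \<longleftrightarrow> f 0 = 1 \<and> f 1 = fps_X * (g 0 + 1) \<and> f 2 = fps_X * (g 1 + g 0 + 1) \<and>
     (\<forall>k. f (k + 3) = fps_X * (g (k + 2) + g (k + 1))) \<and>
     (\<forall>k. g k = fps_X * (f (k + 1) + f (k + 2)))"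

lemma zigzag_system_gf: "zigzag_system f_fps g_fps"
  unfolding zigzag_system_def
proof (intro conjI allI)
  show "f_fps 0 = 1"
  proof (rule fps_ext)
    fix n show "f_fps 0 $ n = 1 $ n"
      by (cases n) (simp_all add: f_fps_def f_paths_0 f_paths_0_Suc)
  qed
next
  show "f_fps 1 = fps_X * (g_fps 0 + 1)"
  proof (rule fps_ext)
    fix n show "f_fps 1 $ n = (fps_X * (g_fps 0 + 1)) $ n"
      by (cases n) (simp_all add: f_fps_def g_fps_def f_paths_0 card_f_paths_Suc card_ground_paths)
  qed
next
  show "f_fps 2 = fps_X * (g_fps 1 + g_fps 0 + 1)"
  proof (rule fps_ext)
    fix n show "f_fps 2 $ n = (fps_X * (g_fps 1 + g_fps 0 + 1)) $ n"
      by (cases n) (simp_all add: f_fps_def g_fps_def f_paths_0 card_f_paths_Suc card_ground_paths)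
  qed
next
  fix k
  show "f_fps (k + 3) = fps_X * (g_fps (k + 2) + g_fps (k + 1))"
  proof (rule fps_ext)
    fix n show "f_fps (k + 3) $ n = (fps_X * (g_fps (k + 2) + g_fps (k + 1))) $ n"
      by (cases n) (simp_all add: f_fps_def g_fps_def f_paths_0 card_f_paths_Suc card_ground_paths
          numeral_eq_Suc)
  qed
next
  fix k
  show "g_fps k = fps_X * (f_fps (k + 1) + f_fps (k + 2))"
  proof (rule fps_ext)
    fix n show "g_fps k $ n = (fps_X * (f_fps (k + 1) + f_fps (k + 2))) $ n"
      by (cases n) (simp_all add: f_fps_def g_fps_def g_paths_0 card_g_paths_Suc)
  qed
qed

lemma nat_cases_3:
  fixes n :: nat
  obtains "n = 0" | "n = 1" | "n = 2" | k where "n = k + 3"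
proof -
  have "n = 0 \<or> n = 1 \<or> n = 2 \<or> n = (n - 3) + 3" by arith
  then show ?thesis using that by blast
qed

lemma zigzag_system_unique:
  assumes 1: "zigzag_system f g" and 2: "zigzag_system f' g'"
  shows "f k = f' k \<and> g k = g' k"
proof -
  have F: "f 0 = 1" "f 1 = fps_X * (g 0 + 1)" "f 2 = fps_X * (g 1 + g 0 + 1)"
      "\<And>k. f (k + 3) = fps_X * (g (k + 2) + g (k + 1))"
    and G: "\<And>k. g k = fps_X * (f (k + 1) + f (k + 2))"
    using 1 unfolding zigzag_system_def by blast+
  have F': "f' 0 = 1" "f' 1 = fps_X * (g' 0 + 1)" "f' 2 = fps_X * (g' 1 + g' 0 + 1)"
      "\<And>k. f' (k + 3) = fps_X * (g' (k + 2) + g' (k + 1))"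
    and G': "\<And>k. g' k = fps_X * (f' (k + 1) + f' (k + 2))"
    using 2 unfolding zigzag_system_def by blast+
  \<comment> \<open>All heights are treated at once: \<open>f\<close> refers to lower heights,
    \<open>g\<close> to higher ones, but always at the previous power of z.\<close>
  have "\<forall>k. f k $ n = f' k $ n \<and> g k $ n = g' k $ n" for n
  proof (induction n)
    case 0
    have "f k $ 0 = f' k $ 0" for k
      by (cases k rule: nat_cases_3) (simp_all only: F F', simp_all)
    moreover have "g k $ 0 = g' k $ 0" for k
      unfolding G[of k] G'[of k] by simp
    ultimately show ?case by blast
  next
    case (Suc n)
    have "f k $ Suc n = f' k $ Suc n" for k
      by (cases k rule: nat_cases_3) (simp_all only: F F', simp_all add: Suc)
    moreover have "g k $ Suc n = g' k $ Suc n" for k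
      unfolding G[of k] G'[of k] by (simp add: Suc)
    ultimately show ?case by blast
  qed
  then show ?thesis by (simp add: fps_eq_iff)
qed

text \<open>These are the claimed formulas with division by z removed through p / z^2 = (1 + p)^2.
  Since p (2 + p) + 1 = (1 + p)^2, adding the empty path makes \<open>g 0\<close> fit the pattern
  p^k (1 + p)^2 as well.\<close>

lemma zigzag_system_closed_form:
  fixes p :: "real fps"
  assumes p: "p = fps_X\<^sup>2 * (1 + p)\<^sup>2"
  shows "zigzag_system
    (\<lambda>k. if k = 0 then 1 else if k = 1 then fps_X * (1 + p)\<^sup>2 else fps_X * (1 + p) ^ 3 * p ^ (k - 2))
    (\<lambda>k. if k = 0 then p * (2 + p) else p ^ k * (1 + p)\<^sup>2)"
proof -
  \<comment> \<open>The equations for \<open>g\<close>, here at height 0 and in \<open>b\<close> at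
    height j + 1, are where the quadratic equation for p enters; \<open>c\<close> and
    \<open>d\<close> are polynomial identities.\<close>
  have a: "p * (2 + p) = fps_X * (fps_X * (1 + p)\<^sup>2 + fps_X * (1 + p) ^ 3)"
  proof -
    have "fps_X * (fps_X * (1 + p)\<^sup>2 + fps_X * (1 + p) ^ 3) = fps_X\<^sup>2 * (1 + p)\<^sup>2 * (2 + p)"
      by algebra
    then show ?thesis using p by simp
  qed
  have b: "p ^ Suc j * (1 + p)\<^sup>2 =
      fps_X * (fps_X * (1 + p) ^ 3 * p ^ j + fps_X * (1 + p) ^ 3 * p ^ Suc j)" for j
  proof -
    have "fps_X * (fps_X * (1 + p) ^ 3 * p ^ j + fps_X * (1 + p) ^ 3 * p ^ Suc j) =
       (fps_X\<^sup>2 * (1 + p)\<^sup>2) * p ^ j * (1 + p)\<^sup>2"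
      by (simp add: algebra_simps power2_eq_square power3_eq_cube)
    then show ?thesis using p by simp
  qed
  have c: "fps_X * (1 + p) ^ 3 * p ^ Suc k = fps_X * (p ^ (k + 2) * (1 + p)\<^sup>2 + p ^ (k + 1) * (1 + p)\<^sup>2)" for k
    by (simp add: algebra_simps power2_eq_square power3_eq_cube)
  have d: "fps_X * (1 + p)\<^sup>2 = fps_X * (p * (2 + p) + 1)"
    "fps_X * (1 + p) ^ 3 = fps_X * (p * (1 + p)\<^sup>2 + p * (2 + p) + 1)"
    by algebra+
  show ?thesis
    unfolding zigzag_system_def
  proof (intro conjI allI, goal_cases)
    case (4 k)
    then show ?case using c[of k] by (simp add: numeral_3_eq_3)
  next
    case (5 k)
    then show ?case using a b[of "k - 1"] by (cases k) simp_all
  qed (use d in simp_all)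
qed

section \<open>The series r and its quadratic equation\<close>

text \<open>The numerator of r has no terms of order 0 or 1, so the Laurent quotient is a power
  series; squaring out the root gives the quadratic equation.\<close>

lemma r_series_fps:
  obtains p where "r_series = fps_to_fls p" "p = fps_X\<^sup>2 * (1 + p)\<^sup>2"
proof -
  define S :: "real fps" where "S = fps_radical root 2 (1 - 4 * fps_X ^ 2)"
  \<comment> \<open>The radical squares back because \<open>root 2\<close> does so on the constant
    coefficient 1; the exponent is put in successor form to match
    \<open>power_radical\<close>.\<close>
  have S2: "S\<^sup>2 = 1 - 4 * fps_X\<^sup>2"
    unfolding S_def numeral_2_eq_2
    by (rule iffD1[OF power_radical]) (simp_all flip: numeral_2_eq_2)
  have S0: "S $ 0 = 1"
    by (simp add: S_def)
  have "(S\<^sup>2) $ 1 = 2 * S $ 1"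
    by (simp add: power2_eq_square fps_mult_nth S0)
  then have S1: "S $ 1 = 0"
    unfolding S2 by (simp add: fps_numeral_simps numeral_fps_const)
  \<comment> \<open>Division by 2 z^2 becomes a shift by two and a factor 1/2; the shift loses
    nothing because both discarded coefficients vanish, by \<open>S0\<close> and
    \<open>S1\<close>.\<close>
  define p where "p = fps_const (1/2) * fps_shift 2 (1 - 2 * fps_X\<^sup>2 - S)"
  have "fps_shift 2 (1 - 2 * fps_X\<^sup>2 - S) * fps_X ^ 2 = 1 - 2 * fps_X\<^sup>2 - S"
  proof (rule fps_ext)
    fix n
    show "(fps_shift 2 (1 - 2 * fps_X\<^sup>2 - S) * fps_X ^ 2) $ n = (1 - 2 * fps_X\<^sup>2 - S) $ n"
      using S0 S1 by (auto simp: fps_X_power_mult_right_nth numeral_fps_const less_2_cases_iff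
            simp flip: add_2_eq_Suc')
  qed
  moreover have "2 * p = fps_shift 2 (1 - 2 * fps_X\<^sup>2 - S)"
  proof -
    have "fps_const 2 * (fps_const (1/2) * h) = h" for h :: "real fps"
      by (simp flip: mult.assoc)
    then show ?thesis unfolding p_def numeral_fps_const .
  qed
  ultimately have p2: "2 * fps_X\<^sup>2 * p = 1 - 2 * fps_X\<^sup>2 - S"
    by (metis mult.assoc mult.commute)
  \<comment> \<open>Substituting S = 1 - 2 z^2 (1 + p) into S^2 = 1 - 4 z^2 gives this; the nonzero
    factor 4 z^2 then cancels.\<close>
  have "4 * fps_X\<^sup>2 * (fps_X\<^sup>2 * (1 + p)\<^sup>2 - p) = 0"
  proof -
    have "S = 1 - 2 * fps_X\<^sup>2 - 2 * fps_X\<^sup>2 * p" using p2 by simp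
    then show ?thesis using S2 by algebra
  qed
  then have "p = fps_X\<^sup>2 * (1 + p)\<^sup>2" by simp
  moreover have "r_series = fps_to_fls p"
  proof -
    have "1 - 2 * fls_X ^ 2 - fps_to_fls S = fps_to_fls (1 - 2 * fps_X\<^sup>2 - S)"
      by (simp add: fls_times_fps_to_fls fps_to_fls_power)
    also have "\<dots> = fps_to_fls p * (2 * fls_X ^ 2)"
      unfolding p2[symmetric] by (simp add: fls_times_fps_to_fls fps_to_fls_power)
    finally show ?thesis
      unfolding r_series_def S_def by simp
  qed
  ultimately show ?thesis using that by blast
qed

lemma r_series_eq: "r_series = fls_X\<^sup>2 * (1 + r_series)\<^sup>2"
proof -
  obtain p where p: "r_series = fps_to_fls p" "p = fps_X\<^sup>2 * (1 + p)\<^sup>2"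
    by (rule r_series_fps)
  have "fps_to_fls p = fps_to_fls (fps_X\<^sup>2 * (1 + p)\<^sup>2)" using p(2) by simp
  then show ?thesis using p(1) by (simp add: fls_times_fps_to_fls fps_to_fls_power)
qed

section \<open>Closed forms over Laurent series, and the bivariate series\<close>

lemma gf_closed_forms:
  defines "r \<equiv> r_series"
  shows "f_gf 0 = 1"
    and "f_gf 1 = r / fls_X"
    and "f_gf (k + 2) = (1 + r) * r ^ (k + 1) / fls_X"
    and "g_gf 0 = r * (2 + r)"
    and "g_gf (k + 1) = r ^ (k + 2) / fls_X\<^sup>2"
proof -
  obtain p where p: "r_series = fps_to_fls p" "p = fps_X\<^sup>2 * (1 + p)\<^sup>2"
    by (rule r_series_fps)
  note sys = zigzag_system_unique[OF zigzag_system_gf zigzag_system_closed_form[OF p(2)]]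
  have gf: "f_gf k = fps_to_fls (f_fps k)" "g_gf k = fps_to_fls (g_fps k)" for k
    by (simp_all add: f_gf_def g_gf_def f_fps_def g_fps_def)
  have r: "r = fps_to_fls p" by (simp add: r_def p(1))
  note conv = fls_times_fps_to_fls fps_to_fls_power
  \<comment> \<open>The quadratic equation read backwards: in the Laurent field it turns the
    polynomial solution of the system into the quotients by powers of z.\<close>
  have q: "(1 + r)\<^sup>2 = r / fls_X\<^sup>2"
  proof (rule iffD2[OF nonzero_eq_divide_eq])
    show "(1 + r)\<^sup>2 * fls_X\<^sup>2 = r"
      unfolding r_def by (rule trans[OF mult.commute r_series_eq[symmetric]])
  qed simp
  have q1: "fls_X * (1 + r)\<^sup>2 = r / fls_X"
    unfolding q by (simp add: power2_eq_square)
  show "f_gf 0 = 1" using sys[of 0] by (simp add: gf)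
  show "f_gf 1 = r / fls_X" using sys[of 1] q1 by (simp add: gf conv r)
  show "g_gf 0 = r * (2 + r)" using sys[of 0] by (simp add: gf conv r)
  have "f_gf (k + 2) = (fls_X * (1 + r)\<^sup>2) * (1 + r) * r ^ k"
    using sys[of "k + 2"] by (simp add: gf conv r power3_eq_cube power2_eq_square mult_ac)
  then show "f_gf (k + 2) = (1 + r) * r ^ (k + 1) / fls_X"
    unfolding q1 times_divide_eq_left by (simp add: mult_ac)
  have "g_gf (k + 1) = r ^ (k + 1) * (1 + r)\<^sup>2"
    using sys[of "k + 1"] by (simp add: gf conv r)
  then show "g_gf (k + 1) = r ^ (k + 2) / fls_X\<^sup>2"
    unfolding q times_divide_eq_right by (simp add: mult_ac)
qed

text \<open>With denominators cleared, the u^n coefficient on the left is z f_n - r z f_(n-1). As z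
  f_k is geometric with ratio r from k = 2 on, this vanishes for n \<ge> 3; the lower ones are z, r
  (1 - z) and r (1 + r) - r^2 = r.\<close>

lemma F_gf_mult:
  defines "r \<equiv> fps_const r_series" and "z \<equiv> fps_const fls_X" and "u \<equiv> fps_X"
  shows "F_gf * (z * (1 - r * u)) = r * u ^ 2 + u * r * (1 - z) + z"
proof (rule fps_ext)
  fix n
  have lhs: "F_gf * (z * (1 - r * u)) = z * F_gf - fps_X * (z * r * F_gf)"
    by (simp add: u_def algebra_simps)
  have rhs: "r * u ^ 2 + u * r * (1 - z) + z =
     fps_const r_series * fps_X ^ 2 + fps_X * fps_const (r_series * (1 - fls_X)) + fps_const fls_X"
    by (simp add: r_def u_def z_def algebra_simps flip: fps_const_mult fps_const_sub)
  have div: "fls_X * (a / fls_X) = a" for a :: "real fls"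
    by (subst times_divide_eq_right, rule nonzero_mult_div_cancel_left) simp
  have f1: "fls_X * f_gf 1 = r_series"
    unfolding gf_closed_forms(2) by (rule div)
  have f2: "fls_X * f_gf (k + 2) = (1 + r_series) * r_series ^ (k + 1)" for k
    unfolding gf_closed_forms(3) by (rule div)
  show "(F_gf * (z * (1 - r * u))) $ n = (r * u ^ 2 + u * r * (1 - z) + z) $ n"
    unfolding lhs rhs
    \<comment> \<open>Instance 0 serves n = 2; for n = k + 3 the instances n - 2 and n - 3 evaluate
      f at the consecutive heights n and n - 1.\<close>
    using f1 f2[of 0] f2[of "n - 2"] f2[of "n - 3"]
    by (cases n rule: nat_cases_3)
       (simp_all add: F_gf_def r_def z_def gf_closed_forms(1) mult.assoc mult.left_commute[of fls_X]
         algebra_simps numeral_eq_Suc)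
qed

text \<open>Here g_k is geometric from k = 1 on, so only n = 0 and n = 1 contribute; the latter
  gives r (1 + r)^2 - r^2 (2 + r) = r.\<close>

lemma G_gf_mult:
  defines "r \<equiv> fps_const r_series" and "u \<equiv> fps_X"
  shows "G_gf * (1 - r * u) = r * (u + r + 2)"
proof (rule fps_ext)
  fix n
  have lhs: "G_gf * (1 - r * u) = G_gf - fps_X * (r * G_gf)"
    by (simp add: u_def algebra_simps)
  have rhs: "r * (u + r + 2) = fps_X * r + fps_const (r_series * (r_series + 2))"
    by (simp add: r_def u_def algebra_simps numeral_fps_const flip: fps_const_mult fps_const_add)
  \<comment> \<open>The right-hand side is free of z, so g_1 is rewritten as a polynomial in
    r.\<close>
  have q: "r_series ^ 2 / fls_X\<^sup>2 = r_series * (1 + r_series)\<^sup>2"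
  proof -
    have "r_series ^ 2 = (fls_X\<^sup>2 * (1 + r_series)\<^sup>2) * r_series"
      using r_series_eq by (simp add: power2_eq_square)
    also have "\<dots> = r_series * (1 + r_series)\<^sup>2 * fls_X\<^sup>2"
      by (simp only: mult_ac)
    finally show ?thesis by (intro iffD2[OF nonzero_divide_eq_eq]) simp_all
  qed
  consider "n = 0" | "n = Suc 0" | k where "n = Suc (Suc k)"
    by (metis not0_implies_Suc)
  then show "(G_gf * (1 - r * u)) $ n = (r * (u + r + 2)) $ n"
    unfolding lhs rhs
  proof cases
    case 2
    have "g_gf 1 = r_series * (1 + r_series)\<^sup>2"
      using gf_closed_forms(5)[of 0] unfolding add_0 q .
    then show "(G_gf - fps_X * (r * G_gf)) $ n =
        (fps_X * r + fps_const (r_series * (r_series + 2))) $ n"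
      using 2 by (simp add: G_gf_def r_def gf_closed_forms(4)) (simp add: algebra_simps power2_eq_square)
  next
    case (3 k)
    have "g_gf ((k + 1) + 1) = r_series * g_gf (k + 1)"
      unfolding gf_closed_forms(5) times_divide_eq_right by (simp only: power_Suc add_Suc flip: Suc_eq_plus1)
    then show "(G_gf - fps_X * (r * G_gf)) $ n =
        (fps_X * r + fps_const (r_series * (r_series + 2))) $ n"
      using 3 by (simp add: G_gf_def r_def)
  qed (simp add: G_gf_def r_def gf_closed_forms(4) algebra_simps)
qed

theorem theorem4:
  "(let u = fps_X; r = fps_const r_series; z = fps_const fls_X in
      F_gf = (r * u ^ 2 + u * r * (1 - z) + z) / (z * (1 - r * u)) \<and>
      G_gf = r * (u + r + 2) / (1 - r * u) \<and>
      F_gf + G_gf = (r ^ 2 * z + r * u ^ 2 + r * u + 2 * r * z + z) / (z * (1 - r * u))) \<and>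
   (let r = r_series; z = fls_X in
      f_gf 0 = 1 \<and>
      (\<forall>k\<ge>1. f_gf k = (1 + r) / z * r ^ (k - 1) - (if k = 1 then 1 else 0) * (1 / z)) \<and>
      g_gf 0 = r * (2 + r) \<and>
      (\<forall>k\<ge>1. g_gf k = r ^ (k + 1) / z ^ 2))"
proof -
  define r z u where "r = fps_const r_series" and "z = fps_const (fls_X :: real fls)" and "u = (fps_X :: real fls fps)"
  have nz: "1 - r * u \<noteq> 0" "z \<noteq> 0"
  proof -
    \<comment> \<open>The constant coefficients in u are 1 and the Laurent series z, both
      nonzero.\<close>
    have "(1 - r * u) $ 0 \<noteq> 0" "z $ 0 \<noteq> 0" by (simp_all add: r_def u_def z_def)
    then show "1 - r * u \<noteq> 0" "z \<noteq> 0" by (metis fps_zero_nth)+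
  qed
  note F = F_gf_mult[folded r_def z_def u_def] and G = G_gf_mult[folded r_def u_def]
  \<comment> \<open>The identity for \<open>G_gf\<close> is multiplied by z to reach the common
    denominator.\<close>
  have "(F_gf + G_gf) * (z * (1 - r * u)) = F_gf * (z * (1 - r * u)) + z * (G_gf * (1 - r * u))"
    by (simp add: algebra_simps)
  also have "\<dots> = r ^ 2 * z + r * u ^ 2 + r * u + 2 * r * z + z"
    unfolding F G by (simp add: algebra_simps power2_eq_square)
  finally have FG: "(F_gf + G_gf) * (z * (1 - r * u)) = \<dots>" .
  have eq: "a = b / c" if "a * c = b" "c \<noteq> 0" for a b c :: "real fls fps"
    using that by auto
  have "f_gf k = (1 + r_series) / fls_X * r_series ^ (k - 1) - (if k = 1 then 1 else 0) * (1 / fls_X)"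
    if "k \<ge> 1" for k
  proof (cases "k = 1")
    case True
    \<comment> \<open>At k = 1 the bracket term turns (1 + r) / z into r / z.\<close>
    then show ?thesis using gf_closed_forms(2) by (simp add: field_simps)
  next
    case False
    then have "k = (k - 2) + 2" "k - 1 = (k - 2) + 1" using that by auto
    moreover have "f_gf ((k - 2) + 2) = (1 + r_series) / fls_X * r_series ^ ((k - 2) + 1)"
      unfolding times_divide_eq_left by (rule gf_closed_forms(3))
    ultimately show ?thesis using False by simp
  qed
  moreover have "g_gf k = r_series ^ (k + 1) / fls_X\<^sup>2" if "k \<ge> 1" for k
    using gf_closed_forms(5)[of "k - 1"] that by simp
  ultimately show ?thesis
    using eq[OF F] eq[OF G] eq[OF FG] nz gf_closed_forms(1,4)
    unfolding Let_def r_def z_def u_def by simp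
qed

end
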